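(* Let $Q_1,Q_2\in\mathscr{Q}$ satisfy $\int_0^1 Q_i^-(s)\,ds<\infty$ for $i\in\{1,2\}$. Define $$f(t)=\int_0^t\big(Q_2(r)-Q_1(r)\big)\,dr,\qquad \phi(t)=\max_{0\le s\le t}f(s),\qquad t\in[0,1),$$ and $$Q^*(t)=Q_1(t)\,\mathbf{1}_{\phi(t)>f(t)}+\big(Q_1(t)\vee Q_2(t)\big)\,\mathbf{1}_{\phi(t)=f(t)},\qquad t\in(0,1).$$ Then $Q^*$ is SSD-minimal in $\mathscr{Q}_1(Q_1)\cap\mathscr{Q}_2(Q_2)$.
   Context: "Increasing" means non-decreasing. $\mathscr{Q}$ is the set of all functions $Q:(0,1)\to\mathbb{R}$ that are increasing and right-continuous (upper quantile functions). $Q^-=\max\{-Q,0\}$, $a\vee b=\max\{a,b\}$, and $\mathbf{1}_A$ equals $1$ if the statement $A$ is true and $0$ otherwise. For $Q,Q_0\in\mathscr{Q}$: $Q\succeq_{(1)}Q_0$ (first-order stochastic dominance, FSD) means $Q(t)\ge Q_0(t)$ for all $t\in(0,1)$; $Q\succeq_{(2)}Q_0$ (second-order stochastic dominance, SSD) means $\int_0^tQ(s)\,ds\ge\int_0^tQ_0(s)\,ds$ for all $t\in(0,1)$ (these integrals are well defined in $[-\infty,\infty)$). For $i\in\{1,2\}$, $\mathscr{Q}_i(Q_0)=\{Q\in\mathscr{Q}: Q\succeq_{(i)}Q_0\}$. A function $Q^*$ is called SSD-minimal in $\mathscr{Q}_1(Q_1)\cap\mathscr{Q}_2(Q_2)$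 if $Q^*\in\mathscr{Q}_1(Q_1)\cap\mathscr{Q}_2(Q_2)$ (in particular $Q^*\in\mathscr{Q}$) and $Q\in\mathscr{Q}_2(Q^* )$ for every $Q\in\mathscr{Q}_1(Q_1)\cap\mathscr{Q}_2(Q_2)$. *)

theory Defs
  imports "HOL-Analysis.Analysis"
begin

text \<open>Functions on the open unit interval are represented by total functions
  \<^typ>\<open>real \<Rightarrow> real\<close>; values outside \<open>{0<..<1}\<close> are never inspected.\<close>

definition quantile_functions :: "(real \<Rightarrow> real) set"  (\<open>\<Q>\<close>) where
  "\<Q> = {Q. mono_on {0<..<1} Q \<and> (\<forall>t\<in>{0<..<1}. continuous (at_right t) Q)}"

definition neg_part :: "(real \<Rightarrow> real) \<Rightarrow> real \<Rightarrow> real" where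
  "neg_part Q t = max (- Q t) 0"

definition pos_part :: "(real \<Rightarrow> real) \<Rightarrow> real \<Rightarrow> real" where
  "pos_part Q t = max (Q t) 0"

text \<open>The integral of \<open>Q\<close> over \<open>(0, t)\<close> as an extended real. For \<open>Q \<in> \<Q>\<close> and \<open>t \<in> (0, 1)\<close>,
  \<open>Q\<close> is bounded above by \<open>Q t\<close> on \<open>(0, t)\<close>, so the first term is finite, the difference is
  never \<open>\<infinity> - \<infinity>\<close>, and the value lies in \<open>[-\<infinity>, \<infinity>)\<close>. (The Bochner integral would
  return 0 instead of \<open>-\<infinity>\<close> when the negative part is not integrable.)\<close>

definition lower_integral :: "(real \<Rightarrow> real) \<Rightarrow> real \<Rightarrow> ereal" where
  "lower_integral Q t =
     enn2ereal (\<integral>\<^sup>+ s\<in>{0<..<t}. ennreal (pos_part Q s) \<partial>lborel)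
   - enn2ereal (\<integral>\<^sup>+ s\<in>{0<..<t}. ennreal (neg_part Q s) \<partial>lborel)"

definition fsd :: "(real \<Rightarrow> real) \<Rightarrow> (real \<Rightarrow> real) \<Rightarrow> bool"  (infix \<open>\<succeq>\<^sub>1\<close> 50) where
  "Q \<succeq>\<^sub>1 Q0 \<longleftrightarrow> (\<forall>t\<in>{0<..<1}. Q t \<ge> Q0 t)"

definition ssd :: "(real \<Rightarrow> real) \<Rightarrow> (real \<Rightarrow> real) \<Rightarrow> bool"  (infix \<open>\<succeq>\<^sub>2\<close> 50) where
  "Q \<succeq>\<^sub>2 Q0 \<longleftrightarrow> (\<forall>t\<in>{0<..<1}. lower_integral Q t \<ge> lower_integral Q0 t)"

definition fsd_set :: "(real \<Rightarrow> real) \<Rightarrow> (real \<Rightarrow> real) set"  (\<open>\<Q>\<^sub>1\<close>) where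
  "\<Q>\<^sub>1 Q0 = {Q \<in> \<Q>. Q \<succeq>\<^sub>1 Q0}"

definition ssd_set :: "(real \<Rightarrow> real) \<Rightarrow> (real \<Rightarrow> real) set"  (\<open>\<Q>\<^sub>2\<close>) where
  "\<Q>\<^sub>2 Q0 = {Q \<in> \<Q>. Q \<succeq>\<^sub>2 Q0}"

definition ssd_minimal :: "(real \<Rightarrow> real) \<Rightarrow> (real \<Rightarrow> real) set \<Rightarrow> bool" where
  "ssd_minimal Qs A \<longleftrightarrow> Qs \<in> A \<and> (\<forall>Q\<in>A. Q \<in> \<Q>\<^sub>2 Qs)"

end

theory Submission imports Defs begin

text \<open>The key identity is \<open>\<integral>\<^sub>0\<^sup>t (Q\<^sup>* - Q\<^sub>1) = \<phi>(t)\<close>. Both sides are continuous, and both have right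
  derivative \<open>Q\<^sup>* - Q\<^sub>1\<close> everywhere in the interior: \<open>\<phi>\<close> is locally constant to the right of a point
  with \<open>f < \<phi>\<close>, and where \<open>f = \<phi>\<close> its right derivative is the positive part of that of \<open>f\<close>, namely
  of \<open>Q\<^sub>2 - Q\<^sub>1\<close>. Minimality follows: for any competitor \<open>Q\<close>, the integral of \<open>Q - Q\<^sub>1\<close> is increasing
  and dominates \<open>f\<close>, hence dominates its running maximum \<open>\<phi>\<close>. For monotonicity of \<open>Q\<^sup>*\<close>, if
  \<open>f = \<phi>\<close> at \<open>s\<close> but not at a later \<open>t\<close>, then \<open>Q\<^sub>2 < Q\<^sub>1\<close> somewhere between, so
  \<open>Q\<^sub>2(s) \<le> Q\<^sub>1(t)\<close>.\<close>

section \<open>Running maxima: existence, continuity, local behaviour and right derivatives\<close>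

definition running_max :: "(real \<Rightarrow> real) \<Rightarrow> (real \<Rightarrow> real) \<Rightarrow> bool" where
  "running_max f \<phi> \<longleftrightarrow>
     (\<forall>t\<in>{0..<1}. \<phi> t \<in> f ` {0..t} \<and> (\<forall>s\<in>{0..t}. f s \<le> \<phi> t))"

lemma running_maxE:
  assumes "running_max f \<phi>" "t \<in> {0..<1}"
  obtains s where "s \<in> {0..t}" "\<phi> t = f s"
  using assms unfolding running_max_def by blast

lemma running_max_ge:
  assumes "running_max f \<phi>" "s \<in> {0..t}" "t < 1"
  shows "f s \<le> \<phi> t"
  using assms unfolding running_max_def by auto

lemma running_max_mono:
  assumes rm: "running_max f \<phi>" and "0 \<le> s" "s \<le> t" "t < 1"
  shows "\<phi> s \<le> \<phi> t"
proof -
  obtain r where "r \<in> {0..s}" "\<phi> s = f r"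
    using running_maxE[OF rm, of s] assms by auto
  then show ?thesis using running_max_ge[OF rm, of r t] assms by auto
qed

text \<open>\<open>GREATEST\<close> carries information only when a greatest element exists.
  Compactness of [0,t] and continuity of \<open>f\<close> provide one, and from here on only
  \<open>running_max\<close> is used.\<close>

lemma running_max_Greatest:
  assumes cont: "continuous_on {0..<1} f"
    and \<phi>: "\<And>t. t \<in> {0..<1} \<Longrightarrow> \<phi> t = (GREATEST y. y \<in> f ` {0..t})"
  shows "running_max f \<phi>"
  unfolding running_max_def
proof
  fix t :: real assume t: "t \<in> {0..<1}"
  have "continuous_on {0..t} f"
    by (rule continuous_on_subset[OF cont]) (use t in auto)
  then obtain x where x: "x \<in> {0..t}" "\<forall>y\<in>{0..t}. f y \<le> f x"
    using continuous_attains_sup[of "{0..t}" f] t by auto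
  have "(GREATEST y. y \<in> f ` {0..t}) = f x"
    by (rule Greatest_equality) (use x in auto)
  then show "\<phi> t \<in> f ` {0..t} \<and> (\<forall>s\<in>{0..t}. f s \<le> \<phi> t)"
    using \<phi>[OF t] x by auto
qed

text \<open>The running maximum inherits the modulus of continuity of \<open>f\<close>: a maximum
  over [0,y] that is not already attained in [0,x] is attained at some z in (x,y], and there
  \<open>f z\<close> exceeds \<open>f x\<close>, hence also \<open>\<phi> x\<close>, by less than
  \<open>e\<close>.\<close>

lemma running_max_continuous_on:
  assumes rm: "running_max f \<phi>" and cont: "continuous_on {0..<1} f" and b: "b < 1"
  shows "continuous_on {0..b} \<phi>"
proof -
  have "continuous_on {0..b} f"
    by (rule continuous_on_subset[OF cont]) (use b in auto)
  then have uc: "uniformly_continuous_on {0..b} f"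
    by (rule compact_uniformly_continuous) simp
  have "uniformly_continuous_on {0..b} \<phi>"
    unfolding uniformly_continuous_on_def
  proof (intro allI impI)
    fix e :: real assume "e > 0"
    then obtain d where d: "d > 0"
      "\<And>x y. x \<in> {0..b} \<Longrightarrow> y \<in> {0..b} \<Longrightarrow> \<bar>y - x\<bar> < d \<Longrightarrow> \<bar>f y - f x\<bar> < e"
      using uc unfolding uniformly_continuous_on_def dist_real_def by metis
    have le: "\<phi> x \<le> \<phi> y \<and> \<phi> y < \<phi> x + e"
      if xy: "0 \<le> x" "x \<le> y" "y \<le> b" "y - x < d" for x y
    proof
      show "\<phi> x \<le> \<phi> y" using running_max_mono[OF rm] xy b by auto
      obtain z where z: "z \<in> {0..y}" "\<phi> y = f z"
        using running_maxE[OF rm, of y] xy b by auto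
      show "\<phi> y < \<phi> x + e"
      proof (cases "z \<le> x")
        case True
        then show ?thesis
          using running_max_ge[OF rm, of z x] z xy b \<open>e > 0\<close> by auto
      next
        case False
        then have "f z < f x + e" using d(2)[of x z] z xy by auto
        also have "f x \<le> \<phi> x" using running_max_ge[OF rm, of x x] xy b by auto
        finally show ?thesis using z by simp
      qed
    qed
    have "\<bar>\<phi> y - \<phi> x\<bar> < e" if "x \<in> {0..b}" "y \<in> {0..b}" "\<bar>y - x\<bar> < d" for x y
      using le[of x y] le[of y x] that by (cases "x \<le> y") auto
    then show "\<exists>d>0. \<forall>x\<in>{0..b}. \<forall>x'\<in>{0..b}. dist x' x < d \<longrightarrow> dist (\<phi> x') (\<phi> x) < e"
      using d(1) unfolding dist_real_def by blast
  qed
  then show ?thesis by (rule uniformly_continuous_imp_continuous)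
qed

text \<open>By continuity \<open>f\<close> stays below \<open>\<phi> c\<close> for a while after
  \<open>c\<close>, so no new maximum can arise there.\<close>

lemma running_max_locally_constant:
  assumes rm: "running_max f \<phi>" and cont: "continuous_on {0..<1} f"
    and c: "c \<in> {0<..<1}" and less: "f c < \<phi> c"
  shows "\<forall>\<^sub>F x in at_right c. \<phi> x = \<phi> c \<and> f x < \<phi> x"
proof -
  have "isCont f c"
    using continuous_on_interior[OF cont, of c] c by simp
  then have "\<forall>\<^sub>F x in at c. f x < \<phi> c"
    using less order_tendstoD(2) unfolding isCont_def by blast
  then have "\<forall>\<^sub>F x in at_right c. f x < \<phi> c"
    by (rule filter_leD[rotated]) (simp add: at_le)
  then obtain b where b: "b > c" "\<And>y. c < y \<Longrightarrow> y < b \<Longrightarrow> f y < \<phi> c"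
    unfolding eventually_at_right_field by blast
  have "\<phi> x = \<phi> c \<and> f x < \<phi> x" if x: "c < x" "x < min b 1" for x
  proof -
    obtain z where z: "z \<in> {0..x}" "\<phi> x = f z"
      using running_maxE[OF rm, of x] x c by auto
    have "f z \<le> \<phi> c"
      using b(2)[of z] running_max_ge[OF rm, of z c] z x c by (cases "z \<le> c") auto
    moreover have "\<phi> c \<le> \<phi> x" using running_max_mono[OF rm] x c by auto
    ultimately show ?thesis using z b(2)[of x] x by auto
  qed
  then show ?thesis
    unfolding eventually_at_right_field by (intro exI[of _ "min b 1"]) (use b c in auto)
qed

text \<open>With an explicit right neighbourhood, the error bound can be applied at the point where
  a maximum is attained, which varies with \<open>x\<close>.\<close>

lemma right_derivative_iff_eps:
  fixes F :: "real \<Rightarrow> real"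
  shows "(F has_real_derivative D) (at_right c) \<longleftrightarrow>
    (\<forall>e>0. \<exists>b>c. \<forall>x. c < x \<and> x < b \<longrightarrow> \<bar>F x - F c - D * (x - c)\<bar> \<le> e * (x - c))"
proof -
  have "(\<forall>\<^sub>F x in at_right c. norm (F x - F c - D * (x - c)) \<le> e * norm (x - c)) \<longleftrightarrow>
    (\<exists>b>c. \<forall>x. c < x \<and> x < b \<longrightarrow> \<bar>F x - F c - D * (x - c)\<bar> \<le> e * (x - c))" for e
    unfolding eventually_at_right_field by auto
  then show ?thesis
    unfolding has_field_derivative_def has_derivative_within_alt2
    by (simp add: bounded_linear_mult_right)
qed

text \<open>From above, the maximum over [0,x] is attained either in [0,c], where it adds nothing to
  \<open>\<phi> c\<close>, or in (c,x], where the linear bound for \<open>f\<close> applies. From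
  below, \<open>\<phi> x\<close> dominates both \<open>\<phi> c\<close> and \<open>f x\<close>,
  which gives slopes 0 and \<open>d\<close>.\<close>

lemma running_max_right_derivative:
  assumes rm: "running_max f \<phi>" and c: "c \<in> {0..<1}" and eq: "\<phi> c = f c"
    and der: "(f has_real_derivative d) (at_right c)"
  shows "(\<phi> has_real_derivative max d 0) (at_right c)"
  unfolding right_derivative_iff_eps
proof (intro allI impI)
  fix e :: real assume e: "e > 0"
  then obtain b where b: "b > c"
    "\<And>x. c < x \<Longrightarrow> x < b \<Longrightarrow> \<bar>f x - f c - d * (x - c)\<bar> \<le> e * (x - c)"
    using der unfolding right_derivative_iff_eps by blast
  have "\<bar>\<phi> x - \<phi> c - max d 0 * (x - c)\<bar> \<le> e * (x - c)" if x: "c < x" "x < min b 1" for x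
  proof -
    have nonneg: "0 \<le> (max d 0 + e) * (x - c)" "0 \<le> e * (x - c)"
      using x e by auto
    obtain z where z: "z \<in> {0..x}" "\<phi> x = f z"
      using running_maxE[OF rm, of x] x c by auto
    have upper: "f z \<le> \<phi> c + (max d 0 + e) * (x - c)"
    proof (cases "z \<le> c")
      case True
      then show ?thesis using running_max_ge[OF rm, of z c] z c nonneg by auto
    next
      case False
      then have "f z \<le> f c + (d + e) * (z - c)"
        using b(2)[of z] z x by (auto simp: algebra_simps)
      \<comment> \<open>\<open>d + e\<close> may be negative, so the slope is made nonnegative
        before \<open>z\<close> is enlarged to \<open>x\<close>.\<close>
      also have "(d + e) * (z - c) \<le> (max d 0 + e) * (z - c)"
        using False by (intro mult_right_mono) auto
      also have "\<dots> \<le> (max d 0 + e) * (x - c)"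
        using z e by (intro mult_left_mono) auto
      finally show ?thesis using eq by simp
    qed
    have "\<phi> c \<le> \<phi> x" using running_max_mono[OF rm] x c by auto
    moreover have "f x \<le> \<phi> x" using running_max_ge[OF rm, of x x] x c by auto
    moreover have "f c + d * (x - c) - e * (x - c) \<le> f x"
      using b(2)[of x] x by auto
    ultimately have "\<phi> c + max d 0 * (x - c) - e * (x - c) \<le> \<phi> x"
      using eq nonneg by (cases "d \<ge> 0") (auto simp: max_def)
    then show ?thesis using upper z by (auto simp: abs_le_iff algebra_simps)
  qed
  then show "\<exists>b>c. \<forall>x. c < x \<and> x < b \<longrightarrow> \<bar>\<phi> x - \<phi> c - max d 0 * (x - c)\<bar> \<le> e * (x - c)"
    by (intro exI[of _ "min b 1"]) (use b c in auto)
qed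

text \<open>With only right derivatives a mean value argument is replaced by a compactness one: the
  points satisfying a linear error bound form a compact set, and its greatest point must be
  \<open>b\<close>, because the right derivative extends the bound past any earlier point.\<close>

lemma constant_if_right_derivative_zero:
  fixes D :: "real \<Rightarrow> real"
  assumes ab: "a \<le> b" and cont: "continuous_on {a..b} D"
    and der: "\<And>c. a < c \<Longrightarrow> c < b \<Longrightarrow> (D has_real_derivative 0) (at_right c)"
  shows "D b = D a"
proof -
  \<comment> \<open>The additive \<open>e\<close> in the bound absorbs the endpoint \<open>a\<close>, where no derivative is assumed.\<close>
  have "\<bar>D b - D a\<bar> \<le> e * (1 + (b - a))" if e: "e > 0" for e
  proof -
    define S where "S = {x \<in> {a..b}. \<bar>D x - D a\<bar> \<le> e * (1 + (x - a))}"
    have "closed S" unfolding S_def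
      by (rule continuous_on_closed_Collect_le) (auto intro!: continuous_intros cont)
    then have "compact S"
      unfolding S_def compact_eq_bounded_closed
      by (auto intro: bounded_subset[OF bounded_closed_interval[of a b]])
    moreover have "a \<in> S" using ab e by (auto simp: S_def)
    ultimately obtain c where c: "c \<in> S" "\<And>x. x \<in> S \<Longrightarrow> x \<le> c"
      using compact_attains_sup[of S] by blast
    have "c = b"
    proof (rule ccontr)
      assume "c \<noteq> b"
      then have cb: "a \<le> c" "c < b" using c by (auto simp: S_def)
      have "\<exists>b'>c. \<forall>x. c < x \<and> x < b' \<longrightarrow> x \<le> b \<longrightarrow> x \<in> S"
      proof (cases "c = a")
        case True
        obtain d where d: "d > 0" "\<And>x. x \<in> {a..b} \<Longrightarrow> \<bar>x - a\<bar> < d \<Longrightarrow> \<bar>D x - D a\<bar> < e"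
          using cont ab e unfolding continuous_on_iff dist_real_def by (metis atLeastAtMost_iff order_refl)
        have "x \<in> S" if "c < x" "x < a + d" "x \<le> b" for x
        proof -
          have "\<bar>D x - D a\<bar> < e" using d(2)[of x] that True by auto
          moreover have "0 \<le> e * (x - a)" using that True e by auto
          ultimately show ?thesis using that True by (auto simp: S_def algebra_simps)
        qed
        then show ?thesis using True d by (intro exI[of _ "a + d"]) auto
      next
        case False
        then obtain b' where b': "b' > c"
          "\<And>x. c < x \<Longrightarrow> x < b' \<Longrightarrow> \<bar>D x - D c\<bar> \<le> e * (x - c)"
          using der[of c] cb e unfolding right_derivative_iff_eps by auto
        have "x \<in> S" if "c < x" "x < b'" "x \<le> b" for x
          using b'(2)[of x] c(1) that by (auto simp: S_def algebra_simps)
        then show ?thesis using b'(1) by blast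
      qed
      then obtain b' where b': "b' > c" "\<And>x. c < x \<Longrightarrow> x < b' \<Longrightarrow> x \<le> b \<Longrightarrow> x \<in> S" by blast
      obtain x where "c < x" "x < min b b'" using dense[of c "min b b'"] cb b' by auto
      then show False using b'(2)[of x] c(2)[of x] by auto
    qed
    then show ?thesis using c by (auto simp: S_def)
  qed
  note le = this
  have "\<bar>D b - D a\<bar> \<le> 0 + e" if "e > 0" for e
  proof -
    have "0 < 1 + (b - a)" using ab by simp
    then show ?thesis using le[of "e / (1 + (b - a))"] that by simp
  qed
  then have "\<bar>D b - D a\<bar> \<le> 0" by (rule field_le_epsilon)
  then show ?thesis by simp
qed

text \<open>Splitting off the constant integral over [a,c] makes \<open>c\<close> the left endpoint,
  where continuity within [c,b] is just right-continuity.\<close>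

lemma integral_right_derivative:
  fixes g :: "real \<Rightarrow> real"
  assumes int: "g integrable_on {a..b}" and c: "a \<le> c" "c < b" and cont: "continuous (at_right c) g"
  shows "((\<lambda>x. integral {a..x} g) has_real_derivative g c) (at_right c)"
proof -
  have "g integrable_on {c..b}"
    by (rule integrable_on_subinterval[OF int]) (use c in auto)
  then have "((\<lambda>x. integral {c..x} g) has_vector_derivative g c) (at c within ({c..b} - {}))"
    by (rule integral_has_vector_derivative_continuous_at)
      (use c cont in \<open>auto simp: at_within_Icc_at_right\<close>)
  then have der: "((\<lambda>x. integral {c..x} g) has_real_derivative g c) (at_right c)"
    using c by (simp add: at_within_Icc_at_right has_real_derivative_iff_has_vector_derivative)
  have "integral {a..x} g = integral {a..c} g + integral {c..x} g" if "c < x" "x < b" for x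
    by (rule Henstock_Kurzweil_Integration.integral_combine[symmetric])
      (use that c in \<open>auto intro: integrable_on_subinterval[OF int]\<close>)
  moreover have "\<forall>\<^sub>F x in at_right c. x \<in> {c<..<b}"
    by (rule eventually_at_right_real) (use c in simp)
  ultimately have "\<forall>\<^sub>F x in at_right c. integral {a..x} g = integral {a..c} g + integral {c..x} g"
    by (auto elim!: eventually_mono)
  moreover have "((\<lambda>x. integral {a..c} g + integral {c..x} g) has_real_derivative g c) (at_right c)"
    using DERIV_add[OF DERIV_const der] by simp
  ultimately show ?thesis
    using has_field_derivative_cong_eventually[where f = "\<lambda>x. integral {a..x} g"] by simp
qed

section \<open>Measurability and integrability of quantile functions\<close>

lemma quantile_mono:
  assumes "Q \<in> \<Q>" "0 < s" "s \<le> t" "t < 1"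
  shows "Q s \<le> Q t"
  using assms mono_onD[of "{0<..<1}" Q s t] by (auto simp: quantile_functions_def)

text \<open>The indicator is essential: \<open>Q\<close> is arbitrary outside (0,1), so
  \<open>Q\<close> itself may fail to be measurable.\<close>

lemma quantile_set_borel_measurable:
  assumes "Q \<in> \<Q>"
  shows "(\<lambda>x. indicator {0<..<1} x * Q x) \<in> borel_measurable borel"
proof -
  have "mono_on {0<..<1} Q" using assms by (simp add: quantile_functions_def)
  then have "Q \<in> borel_measurable (restrict_space borel {0<..<1})"
    by (rule borel_measurable_mono_on_fnc)
  then show ?thesis
    by (subst (asm) borel_measurable_restrict_space_iff) (auto simp: mult.commute)
qed

text \<open>This bridges the extended-real \<open>lower_integral\<close> and the gauge integral used
  for calculus. On (0,t) the positive part is bounded by \<open>\<bar>Q t\<bar>\<close> and the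
  negative part is integrable by hypothesis, so the value is finite.\<close>

lemma quantile_integrable:
  assumes Q: "Q \<in> \<Q>" and neg: "(\<integral>\<^sup>+ s\<in>{0<..<1}. ennreal (neg_part Q s) \<partial>lborel) < \<infinity>"
    and t: "t \<in> {0<..<1}"
  shows "set_integrable lborel {0<..<t} Q"
    and "lower_integral Q t = ereal (integral {0..t} Q)"
proof -
  have [measurable]: "(\<lambda>x. indicator {0<..<1} x * Q x) \<in> borel_measurable borel"
    by (rule quantile_set_borel_measurable[OF Q])
  have pos_eq: "indicator {0<..<t} x * pos_part Q x
      = indicator {0<..<t} x * max (indicator {0<..<1} x * Q x) 0"
    and neg_eq: "indicator {0<..<t} x * neg_part Q x
      = indicator {0<..<t} x * max (- (indicator {0<..<1} x * Q x)) 0" for x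
    using t by (auto simp: pos_part_def neg_part_def indicator_def)
  have pos_meas [measurable]: "(\<lambda>x. indicator {0<..<t} x * pos_part Q x) \<in> borel_measurable borel"
    unfolding pos_eq by measurable
  have neg_meas [measurable]: "(\<lambda>x. indicator {0<..<t} x * neg_part Q x) \<in> borel_measurable borel"
    unfolding neg_eq by measurable
  have "integrable lborel (\<lambda>x. indicator {0<..<t} x * pos_part Q x)"
  proof (rule integrableI_bounded_set[where A = "{0<..<t}" and B = "\<bar>Q t\<bar>"])
    have "Q x \<le> Q t" if "0 < x" "x < t" for x
      using quantile_mono[OF Q] that t by auto
    then show "AE x in lborel. x \<in> {0<..<t} \<longrightarrow> norm (indicator {0<..<t} x * pos_part Q x) \<le> \<bar>Q t\<bar>"
      by (intro AE_I2) (force simp: pos_part_def)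
  qed (use t in auto)
  then have pos_int: "set_integrable lborel {0<..<t} (pos_part Q)"
    by (simp add: set_integrable_def)
  have "(\<integral>\<^sup>+ x. ennreal (indicator {0<..<t} x * neg_part Q x) \<partial>lborel)
      \<le> (\<integral>\<^sup>+ s\<in>{0<..<1}. ennreal (neg_part Q s) \<partial>lborel)"
    by (intro nn_integral_mono) (use t in \<open>auto simp: indicator_def\<close>)
  also note neg
  finally have "(\<integral>\<^sup>+ x. ennreal (indicator {0<..<t} x * neg_part Q x) \<partial>lborel) < \<infinity>" .
  moreover have "AE x in lborel. 0 \<le> indicator {0<..<t} x * neg_part Q x"
    by (simp add: neg_part_def)
  ultimately have "integrable lborel (\<lambda>x. indicator {0<..<t} x * neg_part Q x)"
    using neg_meas by (intro integrableI_nonneg) simp_all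
  then have neg_int: "set_integrable lborel {0<..<t} (neg_part Q)"
    by (simp add: set_integrable_def)
  have Q_eq: "pos_part Q x - neg_part Q x = Q x" for x
    by (auto simp: pos_part_def neg_part_def)
  show Q_int: "set_integrable lborel {0<..<t} Q"
    using set_integral_diff(1)[OF pos_int neg_int] by (simp add: Q_eq)
  have nn_eq: "(\<integral>\<^sup>+ s\<in>{0<..<t}. ennreal (h s) \<partial>lborel) = ennreal (LINT s:{0<..<t}|lborel. h s)"
    if "set_integrable lborel {0<..<t} h" "\<And>x. 0 \<le> h x" for h :: "real \<Rightarrow> real"
    using that unfolding set_integrable_def set_lebesgue_integral_def
    by (subst nn_integral_eq_integral[symmetric])
      (auto simp: nn_integral_set_ennreal mult.commute)
  have nonneg: "0 \<le> pos_part Q x" "0 \<le> neg_part Q x" for x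
    by (auto simp: pos_part_def neg_part_def)
  have "lower_integral Q t
      = ereal (LINT s:{0<..<t}|lborel. pos_part Q s) - ereal (LINT s:{0<..<t}|lborel. neg_part Q s)"
    unfolding lower_integral_def
    using nn_eq[OF pos_int] nn_eq[OF neg_int] nonneg
    by (simp add: set_lebesgue_integral_def enn2ereal_ennreal)
  also have "\<dots> = ereal (LINT s:{0<..<t}|lborel. Q s)"
    using set_integral_diff(2)[OF pos_int neg_int] by (simp add: Q_eq)
  also have "(LINT s:{0<..<t}|lborel. Q s) = integral {0..t} Q"
    using set_borel_integral_eq_integral(2)[OF Q_int] by (simp add: integral_open_interval_real)
  finally show "lower_integral Q t = ereal (integral {0..t} Q)" .
qed

lemma quantile_integrable_on:
  assumes "Q \<in> \<Q>" "(\<integral>\<^sup>+ s\<in>{0<..<1}. ennreal (neg_part Q s) \<partial>lborel) < \<infinity>" "t \<in> {0..<1}"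
  shows "Q integrable_on {0..t}"
proof (cases "t = 0")
  case False
  then have "set_integrable lborel {0<..<t} Q"
    using quantile_integrable(1) assms by auto
  then show ?thesis
    using set_borel_integral_eq_integral(1) integrable_on_open_interval_real by blast
qed (use integrable_on_refl[of Q 0] in simp)

text \<open>Negative parts reverse the order, so finiteness passes from \<open>Q1\<close> to
  everything above it: to \<open>Qstar\<close> and to every competitor.\<close>

lemma neg_part_integral_mono:
  assumes "Q \<succeq>\<^sub>1 Q0" "(\<integral>\<^sup>+ s\<in>{0<..<1}. ennreal (neg_part Q0 s) \<partial>lborel) < \<infinity>"
  shows "(\<integral>\<^sup>+ s\<in>{0<..<1}. ennreal (neg_part Q s) \<partial>lborel) < \<infinity>"
proof -
  have "(\<integral>\<^sup>+ s\<in>{0<..<1}. ennreal (neg_part Q s) \<partial>lborel)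
      \<le> (\<integral>\<^sup>+ s\<in>{0<..<1}. ennreal (neg_part Q0 s) \<partial>lborel)"
  proof (intro nn_integral_mono)
    fix x :: real
    have "neg_part Q x \<le> neg_part Q0 x" if "x \<in> {0<..<1}"
      using assms(1) that by (force simp: fsd_def neg_part_def)
    then show "ennreal (neg_part Q x) * indicator {0<..<1} x
        \<le> ennreal (neg_part Q0 x) * indicator {0<..<1} x"
      by (simp add: indicator_def ennreal_leI)
  qed
  then show ?thesis using assms(2) by simp
qed

text \<open>Where \<open>g\<close> is nonnegative \<open>f\<close> is increasing, so a maximum
  attained at \<open>s\<close> stays attained at the moving endpoint. The contrapositive yields a
  point with \<open>g < 0\<close> whenever \<open>f\<close> falls below its maximum.\<close>

lemma running_max_eq_of_nonneg:
  assumes rm: "running_max f \<phi>" and st: "0 \<le> s" "s \<le> t" "t < 1" and eq: "\<phi> s = f s"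
    and f: "\<And>x. x \<in> {0..<1} \<Longrightarrow> f x = integral {0..x} g"
    and int: "\<And>x. x \<in> {0..<1} \<Longrightarrow> g integrable_on {0..x}"
    and nonneg: "\<And>x. s < x \<Longrightarrow> x < t \<Longrightarrow> 0 \<le> g x"
  shows "\<phi> t = f t"
proof -
  have "f z \<le> f t" if z: "s \<le> z" "z \<le> t" for z
  proof -
    have gint: "g integrable_on {z..t}"
      by (rule integrable_on_subinterval[OF int[of t]]) (use st z in auto)
    have "f t = f z + integral {z..t} g"
      using Henstock_Kurzweil_Integration.integral_combine[of 0 z t g] int[of t] f[of z] f[of t] st z by auto
    \<comment> \<open>The open interval is used because the sign of \<open>g\<close> is known only
      strictly between \<open>s\<close> and \<open>t\<close>.\<close>
    moreover have "0 \<le> integral {z<..<t} g"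
      by (rule integral_nonneg)
        (use nonneg z gint in \<open>auto simp: integrable_on_open_interval_real\<close>)
    ultimately show ?thesis by (simp add: integral_open_interval_real)
  qed
  note mono = this
  obtain z where z: "z \<in> {0..t}" "\<phi> t = f z"
    using running_maxE[OF rm, of t] st by auto
  have "f z \<le> f t"
    using mono[of z] mono[of s] running_max_ge[OF rm, of z s] z st eq by (cases "s \<le> z") auto
  then show ?thesis using z running_max_ge[OF rm, of t t] st by auto
qed

theorem theorem2p4:
  fixes Q1 Q2 Qstar f \<phi> :: "real \<Rightarrow> real"
  assumes "Q1 \<in> \<Q>" and "Q2 \<in> \<Q>"
    and "(\<integral>\<^sup>+ s\<in>{0<..<1}. ennreal (neg_part Q1 s) \<partial>lborel) < \<infinity>"
    and "(\<integral>\<^sup>+ s\<in>{0<..<1}. ennreal (neg_part Q2 s) \<partial>lborel) < \<infinity>"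
    and f: "\<And>t. t \<in> {0..<1} \<Longrightarrow> f t = (LINT r:{0<..<t}|lborel. Q2 r - Q1 r)"
    and \<phi>: "\<And>t. t \<in> {0..<1} \<Longrightarrow> \<phi> t = (GREATEST y. y \<in> f ` {0..t})"
    and Qstar: "\<And>t. t \<in> {0<..<1} \<Longrightarrow>
      Qstar t = Q1 t * of_bool (\<phi> t > f t) + max (Q1 t) (Q2 t) * of_bool (\<phi> t = f t)"
  shows "ssd_minimal Qstar (\<Q>\<^sub>1 Q1 \<inter> \<Q>\<^sub>2 Q2)"
proof -

  \<comment> \<open>The integral function \<open>f\<close> and its continuity\<close>
  define g where "g = (\<lambda>r. Q2 r - Q1 r)"
  note Q1 = assms(1) and Q2 = assms(2) and neg1 = assms(3) and neg2 = assms(4)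
  have mono1: "Q1 s \<le> Q1 t" and mono2: "Q2 s \<le> Q2 t" if "0 < s" "s \<le> t" "t < 1" for s t
    using Q1 Q2 that by (auto intro: quantile_mono)
  have cont1: "(Q1 \<longlongrightarrow> Q1 t) (at_right t)" and cont2: "(Q2 \<longlongrightarrow> Q2 t) (at_right t)"
    if "t \<in> {0<..<1}" for t
    using Q1 Q2 that unfolding quantile_functions_def continuous_within by auto
  have int1: "Q1 integrable_on {0..t}" and int2: "Q2 integrable_on {0..t}"
    and g_int: "g integrable_on {0..t}" if "t \<in> {0..<1}" for t
    using quantile_integrable_on[OF Q1 neg1 that] quantile_integrable_on[OF Q2 neg2 that]
    by (auto simp: g_def intro!: integrable_diff)
  have f_eq: "f t = integral {0..t} g" if t: "t \<in> {0..<1}" for t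
  proof (cases "t = 0")
    case True
    then show ?thesis using f[of 0] by (simp add: set_lebesgue_integral_def)
  next
    case False
    then have "set_integrable lborel {0<..<t} Q1" "set_integrable lborel {0<..<t} Q2"
      using quantile_integrable(1) Q1 neg1 Q2 neg2 t by auto
    then have "set_integrable lborel {0<..<t} g" unfolding g_def by simp
    then show ?thesis
      using f[OF t] set_borel_integral_eq_integral(2)[of "{0<..<t}" g]
      by (simp add: g_def integral_open_interval_real)
  qed
  have f_cont_Icc: "continuous_on {0..b} f" if "b < 1" for b
  proof (cases "0 \<le> b")
    case True
    have "continuous_on {0..b} (\<lambda>x. integral {0..x} g)"
      by (rule indefinite_integral_continuous_1) (use g_int that True in auto)
    then show ?thesis
      by (rule continuous_on_eq) (use f_eq that in auto)
  qed simp
  have f_cont: "continuous_on {0..<1} f"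
    unfolding continuous_on_eq_continuous_within
  proof
    fix x :: real assume x: "x \<in> {0..<1}"
    \<comment> \<open>\<open>Q1\<close> and \<open>Q2\<close> need not be integrable up to 1.
      Continuity is local, so the midpoint between \<open>x\<close> and 1 is a sufficient right
      end.\<close>
    define b where "b = (x + 1) / 2"
    have "continuous (at x within {0..b}) f"
      using f_cont_Icc[of b] x by (auto simp: b_def continuous_on_eq_continuous_within)
    moreover have "at x within {0..<1} = at x within {0..b}"
      by (rule at_within_nhd[of _ "{..<b}"]) (use x in \<open>auto simp: b_def\<close>)
    ultimately show "continuous (at x within {0..<1}) f" by simp
  qed
  have rm: "running_max f \<phi>" by (rule running_max_Greatest[OF f_cont \<phi>])
  have f_le: "f t \<le> \<phi> t" if "t \<in> {0..<1}" for t
    using running_max_ge[OF rm, of t t] that by auto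
  \<comment> \<open>Since \<open>f \<le> \<phi>\<close>, exactly one of the two indicators is
    1.\<close>
  have Qs: "Qstar t = (if \<phi> t = f t then max (Q1 t) (Q2 t) else Q1 t)" if "t \<in> {0<..<1}" for t
    using Qstar[OF that] f_le[of t] that by auto
  have Qs_ge: "Q1 t \<le> Qstar t" if "t \<in> {0<..<1}" for t
    using Qs[OF that] by auto

  \<comment> \<open>Monotonicity and right-continuity of \<open>Qstar\<close>\<close>
  have Qs_mono: "Qstar s \<le> Qstar t" if st: "0 < s" "s \<le> t" "t < 1" for s t
  proof (cases "\<phi> s = f s \<and> \<phi> t \<noteq> f t")
    case True
    then obtain u where u: "s < u" "u < t" "g u < 0"
      using running_max_eq_of_nonneg[OF rm, of s t g] f_eq g_int st by force
    \<comment> \<open>The chain is \<open>Q2 s \<le> Q2 u < Q1 u \<le> Q1 t\<close>.\<close>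
    then have "Q2 s \<le> Q1 t"
      using mono2[of s u] mono1[of u t] st by (auto simp: g_def)
    then show ?thesis using True mono1[of s t] Qs[of s] Qs[of t] st by auto
  next
    case False
    then show ?thesis using mono1[of s t] mono2[of s t] Qs[of s] Qs[of t] st by auto
  qed

  have Qs_cont: "(Qstar \<longlongrightarrow> Qstar c) (at_right c)" if c: "c \<in> {0<..<1}" for c
  proof -
    have ev1: "\<forall>\<^sub>F x in at_right c. x \<in> {c<..<1}"
      using eventually_at_right_real[of c 1] c by simp
    consider "f c < \<phi> c" | "\<phi> c = f c" "Q2 c \<le> Q1 c" | "\<phi> c = f c" "Q1 c < Q2 c"
      using f_le[of c] c by force
    then show ?thesis
    proof cases
      case 1
      have "\<forall>\<^sub>F x in at_right c. Q1 x = Qstar x"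
        using running_max_locally_constant[OF rm f_cont c 1] ev1
        by eventually_elim (use Qs c in auto)
      then show ?thesis
        using cont1[OF c] 1 Qs[OF c] by (simp add: tendsto_cong)
    next
      \<comment> \<open>\<open>f\<close> may leave and regain its maximum arbitrarily close to
        \<open>c\<close>, so neither branch need persist. Instead \<open>Qstar\<close> is squeezed
        between \<open>Q1\<close> and the pointwise maximum, which share the limit
        \<open>Q1 c\<close>.\<close>
      case 2
      then have "Qstar c = Q1 c" using Qs[OF c] by auto
      moreover have "((\<lambda>x. max (Q1 x) (Q2 x)) \<longlongrightarrow> max (Q1 c) (Q2 c)) (at_right c)"
        by (intro tendsto_intros cont1 cont2 c)
      moreover have "\<forall>\<^sub>F x in at_right c. Q1 x \<le> Qstar x"
        "\<forall>\<^sub>F x in at_right c. Qstar x \<le> max (Q1 x) (Q2 x)"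
        using ev1 by (eventually_elim; use Qs c in auto)+
      ultimately show ?thesis
        using cont1[OF c] 2 tendsto_sandwich[of Q1 Qstar "at_right c"] by (auto simp: max_def)
    next
      \<comment> \<open>Right-continuity keeps \<open>g\<close> positive just after
        \<open>c\<close>, so \<open>f\<close> keeps attaining its maximum and the upper branch
        persists.\<close>
      case 3
      have "((\<lambda>x. g x) \<longlongrightarrow> g c) (at_right c)"
        unfolding g_def by (intro tendsto_intros cont1 cont2 c)
      then have "\<forall>\<^sub>F x in at_right c. 0 < g x"
        by (rule order_tendstoD) (use 3 in \<open>simp add: g_def\<close>)
      then obtain b where b: "b > c" "\<And>x. c < x \<Longrightarrow> x < b \<Longrightarrow> 0 < g x"
        unfolding eventually_at_right_field by blast
      have "\<forall>\<^sub>F x in at_right c. x \<in> {c<..<b}"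
        using eventually_at_right_real[of c b] b by simp
      then have "\<forall>\<^sub>F x in at_right c. max (Q1 x) (Q2 x) = Qstar x"
        using ev1
      proof eventually_elim
        case (elim x)
        have "\<phi> x = f x"
          by (rule running_max_eq_of_nonneg[OF rm, of c x g])
            (use elim c 3 f_eq g_int b(2) in \<open>auto intro: less_imp_le\<close>)
        then show ?case using Qs[of x] elim c by auto
      qed
      moreover have "((\<lambda>x. max (Q1 x) (Q2 x)) \<longlongrightarrow> max (Q1 c) (Q2 c)) (at_right c)"
        by (intro tendsto_intros cont1 cont2 c)
      ultimately show ?thesis using 3 Qs[OF c] by (simp add: tendsto_cong)
    qed
  qed
  have Qs_in: "Qstar \<in> \<Q>"
    unfolding quantile_functions_def continuous_within
    using Qs_mono Qs_cont by (auto intro!: mono_onI)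
  have fsd: "Qstar \<succeq>\<^sub>1 Q1" using Qs_ge by (auto simp: fsd_def)
  note negs = neg_part_integral_mono[OF fsd neg1]

  \<comment> \<open>The integral of \<open>Qstar - Q1\<close> equals \<phi>\<close>
  have Qs_int: "Qstar integrable_on {0..t}" if "t \<in> {0..<1}" for t
    by (rule quantile_integrable_on[OF Qs_in negs that])
  have phi_eq: "integral {0..t} Qstar = integral {0..t} Q1 + \<phi> t" if t: "t \<in> {0<..<1}" for t
  proof -
    define h where "h = (\<lambda>x. Qstar x - Q1 x)"
    have h_int: "h integrable_on {0..x}" if "x \<in> {0..<1}" for x
      unfolding h_def by (intro integrable_diff Qs_int int1 that)
    \<comment> \<open>Right derivatives are computed only for \<open>c > 0\<close>: quantile
      functions may be unbounded below near 0, and their values at 0 mean nothing.\<close>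
    define D where "D = (\<lambda>x. \<phi> x - integral {0..x} h)"
    have "D t = D 0"
    proof (rule constant_if_right_derivative_zero[where D = D and a = 0 and b = t])
      show "continuous_on {0..t} D"
        unfolding D_def using t
        by (intro continuous_intros running_max_continuous_on[OF rm f_cont]
            indefinite_integral_continuous_1 h_int) auto
    next
      fix c assume c: "0 < c" "c < t"
      then have c1: "c \<in> {0<..<1}" using t by auto
      have "continuous (at_right c) h" "continuous (at_right c) g"
        unfolding continuous_within h_def g_def
        using c1 by (auto intro!: tendsto_intros cont1 cont2 Qs_cont)
      then have dh: "((\<lambda>x. integral {0..x} h) has_real_derivative h c) (at_right c)"
        and dg: "((\<lambda>x. integral {0..x} g) has_real_derivative g c) (at_right c)"
        using integral_right_derivative[of _ 0 t c] h_int[of t] g_int[of t] c t by auto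
      have "(\<phi> has_real_derivative h c) (at_right c)"
      proof (cases "\<phi> c = f c")
        case True
        have ev: "\<forall>\<^sub>F x in at_right c. integral {0..x} g = f x"
          using eventually_at_right_real[of c 1] c1 by (auto elim!: eventually_mono simp: f_eq)
        have "(f has_real_derivative g c) (at_right c)"
          using has_field_derivative_cong_eventually[OF ev] dg f_eq[of c] c1 by simp
        then have "(\<phi> has_real_derivative max (g c) 0) (at_right c)"
          using running_max_right_derivative[OF rm _ True] c1 by auto
        moreover have "max (g c) 0 = h c"
          using True Qs[OF c1] by (auto simp: g_def h_def)
        ultimately show ?thesis by simp
      next
        case False
        then have "f c < \<phi> c" using f_le[of c] c1 by auto
        then have "\<forall>\<^sub>F x in at_right c. \<phi> x = \<phi> c"
          using running_max_locally_constant[OF rm f_cont c1] by (auto elim: eventually_mono)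
        then have "(\<phi> has_real_derivative 0) (at_right c)"
          using has_field_derivative_cong_eventually[of \<phi> "\<lambda>_. \<phi> c" c "{c<..}" 0] by simp
        moreover have "h c = 0" using False Qs[OF c1] by (auto simp: h_def)
        ultimately show ?thesis by simp
      qed
      show "(D has_real_derivative 0) (at_right c)"
        using DERIV_diff[OF \<open>(\<phi> has_real_derivative h c) (at_right c)\<close> dh] by (simp add: D_def)
    qed (use t in auto)
    moreover have "\<phi> 0 = 0"
      using bspec[OF rm[unfolded running_max_def], of 0] f_eq[of 0] by simp
    ultimately have "\<phi> t = integral {0..t} h" by (simp add: D_def)
    then show ?thesis
      unfolding h_def using Qs_int[of t] int1[of t] t by (simp add: integral_diff)
  qed

  \<comment> \<open>Second-order dominance and minimality\<close>
  have f_diff: "f t = integral {0..t} Q2 - integral {0..t} Q1" if "t \<in> {0..<1}" for t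
    using f_eq[OF that] int1[OF that] int2[OF that] by (simp add: g_def integral_diff)
  have ssd: "Qstar \<succeq>\<^sub>2 Q2"
    unfolding ssd_def
  proof
    fix t :: real assume t: "t \<in> {0<..<1}"
    \<comment> \<open>After subtracting the integral of \<open>Q1\<close>, this is
      \<open>f t \<le> \<phi> t\<close>.\<close>
    then show "lower_integral Q2 t \<le> lower_integral Qstar t"
      using quantile_integrable(2)[OF Q2 neg2 t] quantile_integrable(2)[OF Qs_in negs t]
        phi_eq[OF t] f_le[of t] f_diff[of t] by auto
  qed
  have "Q \<succeq>\<^sub>2 Qstar" if Q: "Q \<in> \<Q>" "Q \<succeq>\<^sub>1 Q1" "Q \<succeq>\<^sub>2 Q2" for Q
    unfolding ssd_def
  proof
    fix t :: real assume t: "t \<in> {0<..<1}"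
    note negQ = neg_part_integral_mono[OF Q(2) neg1]
    define k where "k = (\<lambda>x. Q x - Q1 x)"
    have Q_int: "Q integrable_on {0..x}" if "x \<in> {0..<1}" for x
      by (rule quantile_integrable_on[OF Q(1) negQ that])
    have k_int: "k integrable_on {0..x}" if "x \<in> {0..<1}" for x
      unfolding k_def by (intro integrable_diff Q_int int1 that)
    have k_eq: "integral {0..x} k = integral {0..x} Q - integral {0..x} Q1" if "x \<in> {0..<1}" for x
      unfolding k_def by (intro integral_diff Q_int int1 that)
    \<comment> \<open>At a maximiser \<open>s\<close> of \<open>f\<close> on [0,t], dominance over
      \<open>Q2\<close> bounds \<open>f s\<close> by the integral of \<open>k\<close> up to
      \<open>s\<close>, and \<open>Q \<succeq>\<^sub>1 Q1\<close> extends this bound to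
      \<open>t\<close>. The case \<open>s = 0\<close> is separate because \<open>ssd\<close> speaks
      only of (0,1).\<close>
    obtain s where s: "s \<in> {0..t}" "\<phi> t = f s"
      using running_maxE[OF rm, of t] t by auto
    have "f s \<le> integral {0..s} k"
    proof (cases "s = 0")
      case True
      then show ?thesis using f_eq[of 0] by simp
    next
      case False
      then have s1: "s \<in> {0<..<1}" using s t by auto
      then have "lower_integral Q2 s \<le> lower_integral Q s"
        using Q(3) by (auto simp: ssd_def)
      then show ?thesis
        using quantile_integrable(2)[OF Q2 neg2 s1] quantile_integrable(2)[OF Q(1) negQ s1]
          f_diff[of s] k_eq[of s] s1 by auto
    qed
    \<comment> \<open>Passing to open intervals discards the endpoint 0, where \<open>k\<close> may
      be negative.\<close>
    also have "integral {0..s} k = integral {0<..<s} k" by (simp add: integral_open_interval_real)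
    also have "\<dots> \<le> integral {0<..<t} k"
      by (rule integral_subset_le)
        (use s t k_int Q(2) in \<open>auto simp: integrable_on_open_interval_real k_def fsd_def\<close>)
    also have "\<dots> = integral {0..t} k" by (simp add: integral_open_interval_real)
    finally show "lower_integral Qstar t \<le> lower_integral Q t"
      using s(2) k_eq[of t] phi_eq[OF t] t quantile_integrable(2)[OF Q(1) negQ t]
        quantile_integrable(2)[OF Qs_in negs t] by auto
  qed
  then show ?thesis
    using Qs_in fsd ssd by (auto simp: ssd_minimal_def fsd_set_def ssd_set_def)
qed

end
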